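(* Let $R=(R,\mathcal G_0,\nu)$ be a supertropical semiring, let $n\ge 1$, and let $A,B\in M_n(R)$. Then $$|AB|^\nu \ \ge\ |A|^\nu\,|B|^\nu ,$$ and $|AB|=|A|\,|B|$ whenever $|AB|$ is tangible. In other words, $|AB|=|A|\,|B|+\text{ghost}$, i.e. there is $c\in\mathcal G_0$ with $|AB|=|A|\,|B|+c$.
   Context: A supertropical semiring $(R,\mathcal G_0,\nu)$ is a commutative semiring $R$ with unit $\mathbb 1$ and zero $\mathbb 0$ (with $\mathbb 0 r=\mathbb 0$ for all $r$), a semiring ideal $\mathcal G_0=\mathcal G\cup\{\mathbb 0\}$ (the ghost ideal, where $\mathcal G=\mathcal G_0\setminus\{\mathbb 0\}$), and an idempotent map $\nu:R\to\mathcal G_0$, written $a^\nu=\nu(a)$, preserving addition and multiplication, given by $\nu(a)=a+a$ and equal to the identity on $\mathcal G_0$, such that $a+b=a^\nu$ if $a^\nu=b^\nu$, and $a+b\in\{a,b\}$ if $a^\nu\ne b^\nu$. $\mathcal G_0$ is totally ordered by $a^\nu\le b^\nu$ iff $a^\nu+b^\nu=b^\nu$. The set of tangible elements is $\mathcal T=R\setminus\mathcal G_0$. For $A=(a_{i,j})\in M_n(R)$ the tropical determinant is the permanent $|A|=\sum_{\pi\in S_n}a_{1,\pi(1)}\cdots a_{n,\pi(n)}$. *)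

theory Defs
  imports "HOL-Combinatorics.Permutations" "Jordan_Normal_Form.Matrix"
begin

text \<open>The sort \<open>{comm_semiring_0, comm_monoid_mult}\<close> is that of commutative semirings with zero
  and unit; unlike \<open>comm_semiring_1\<close> it does not demand \<open>0 \<noteq> 1\<close>.\<close>

locale supertropical_semiring =
  fixes G0 :: "'a :: {comm_semiring_0, comm_monoid_mult} set"
    and \<nu> :: "'a \<Rightarrow> 'a"
  assumes zero_in_G0: "0 \<in> G0"
    and add_in_G0: "g \<in> G0 \<Longrightarrow> h \<in> G0 \<Longrightarrow> g + h \<in> G0"
    and mult_in_G0: "g \<in> G0 \<Longrightarrow> r * g \<in> G0"
    and nu_in_G0: "\<nu> a \<in> G0"
    and nu_idem: "\<nu> (\<nu> a) = \<nu> a"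
    and nu_add: "\<nu> (a + b) = \<nu> a + \<nu> b"
    and nu_mult: "\<nu> (a * b) = \<nu> a * \<nu> b"
    and nu_eq: "\<nu> a = a + a"
    and nu_id: "g \<in> G0 \<Longrightarrow> \<nu> g = g"
    and add_nu_eq: "\<nu> a = \<nu> b \<Longrightarrow> a + b = \<nu> a"
    and add_nu_neq: "\<nu> a \<noteq> \<nu> b \<Longrightarrow> a + b \<in> {a, b}"

definition tangible :: "'a set \<Rightarrow> 'a set" where
  "tangible G0 = UNIV - G0"

definition ghost_le :: "'a :: plus set \<Rightarrow> 'a \<Rightarrow> 'a \<Rightarrow> bool" where
  "ghost_le G0 g h \<longleftrightarrow> g \<in> G0 \<and> h \<in> G0 \<and> g + h = h"

text \<open>That the order on the ghost ideal is total need not be assumed: it follows from the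
  rules for addition.\<close>

lemma (in supertropical_semiring) ghost_le_linear_order:
  "linear_order_on G0 {(g, h). ghost_le G0 g h}"
proof -
  have "g + g = g" if "g \<in> G0" for g
    using nu_eq[of g] nu_id[OF that] by simp
  moreover have "g + h = h \<or> h + g = g" if "g \<in> G0" "h \<in> G0" for g h
  proof (cases "g = h")
    case True
    then show ?thesis using nu_eq[of g] nu_id[OF that(1)] by simp
  next
    case False
    then show ?thesis
      using add_nu_neq[of g h] nu_id[OF that(1)] nu_id[OF that(2)]
      by (simp add: add.commute[of h g]) blast
  qed
  moreover have "g + k = k" if "g + h = h" "h + k = k" for g h k :: 'a
  proof -
    have "g + k = g + (h + k)" using that(2) by simp
    also have "\<dots> = (g + h) + k" by (simp only: add.assoc)
    also have "\<dots> = k" using that by simp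
    finally show ?thesis .
  qed
  moreover have "g = h" if "g + h = h" "h + g = g" for g h :: 'a
    using that add.commute[of g h] by simp
  ultimately show ?thesis
    unfolding linear_order_on_def partial_order_on_def preorder_on_def refl_on_def trans_def
      antisym_def total_on_def ghost_le_def by blast
qed

definition trop_det :: "'a :: {comm_semiring_0, comm_monoid_mult} mat \<Rightarrow> 'a" where
  "trop_det A = (\<Sum>\<pi> | \<pi> permutes {0..<dim_row A}. \<Prod>i = 0..<dim_row A. A $$ (i, \<pi> i))"

end

theory Submission
  imports Defs
begin

text \<open>
  Over every commutative semiring, \<open>|AB| = |A| |B| + (d + d)\<close> for some \<open>d\<close> (lemma
  \<open>permanent_mult\<close>). Distributing the products in \<open>|AB|\<close> over the sums that
  form the entries of \<open>AB\<close> gives one term for each choice \<open>f\<close> of intermediate indices: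
  \<open>|AB| = \<Sum>f. (\<Prod>i. a i (f i)) * |B\<^sub>f|\<close>, where row \<open>i\<close> of \<open>B\<^sub>f\<close> is row \<open>f i\<close> of \<open>B\<close>. If \<open>f\<close> is a
  permutation, then \<open>|B\<^sub>f| = |B|\<close> (\<open>permanent_permute_rows\<close>), and these \<open>f\<close> together contribute
  \<open>|A| |B|\<close>. If not, then \<open>B\<^sub>f\<close> has two equal rows. Where a determinant would vanish by
  cancellation of opposite terms, the same pairing of even with odd permutations makes the
  permanent a double (\<open>permanent_equal_rows\<close>).

  In a supertropical semiring \<open>d + d\<close> is the ghost \<open>\<nu> d\<close>, so \<open>|AB| = |A| |B| + ghost\<close>. The other
  two assertions are general facts about adding a ghost: it can only enlarge the \<open>\<nu>\<close>-value
  (\<open>ghost_le_nu_add\<close>), and if the sum is tangible, the ghost was dominated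
  (\<open>add_ghost_tangible\<close>).
\<close>

text \<open>Distributivity in the generality needed here: unlike in the class \<open>comm_semiring_1\<close>,
  \<open>0 = 1\<close> is admitted.\<close>

lemma prod_sum_expand_PiE:
  fixes F :: "'i \<Rightarrow> 'j \<Rightarrow> 'a :: {comm_semiring_0, comm_monoid_mult}"
  assumes "finite I" and "finite J"
  shows "(\<Prod>i\<in>I. \<Sum>j\<in>J. F i j) = (\<Sum>f\<in>I \<rightarrow>\<^sub>E J. \<Prod>i\<in>I. F i (f i))"
  using assms(1)
proof induction
  case empty
  show ?case by simp
next
  case (insert x I)
  let ?upd = "\<lambda>(y, f). f(x := y)"
  have inj: "inj_on ?upd (J \<times> (I \<rightarrow>\<^sub>E J))"
    using insert.hyps(2) by (rule inj_combinator)
  have prod: "(\<Prod>i\<in>insert x I. F i ((f(x := y)) i)) = F x y * (\<Prod>i\<in>I. F i (f i))" for f y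
  proof -
    have "(\<Prod>i\<in>I. F i ((f(x := y)) i)) = (\<Prod>i\<in>I. F i (f i))"
      using insert.hyps(2) by (intro prod.cong) auto
    then show ?thesis using insert.hyps by simp
  qed
  have "(\<Sum>f\<in>insert x I \<rightarrow>\<^sub>E J. \<Prod>i\<in>insert x I. F i (f i))
      = (\<Sum>(y, f)\<in>J \<times> (I \<rightarrow>\<^sub>E J). F x y * (\<Prod>i\<in>I. F i (f i)))"
    unfolding PiE_insert_eq sum.reindex[OF inj] comp_def
    by (intro sum.cong refl) (auto simp: prod simp del: fun_upd_apply)
  also have "\<dots> = (\<Sum>y\<in>J. F x y) * (\<Sum>f\<in>I \<rightarrow>\<^sub>E J. \<Prod>i\<in>I. F i (f i))"
    by (simp add: sum_product sum.cartesian_product)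
  also have "\<dots> = (\<Prod>i\<in>insert x I. \<Sum>j\<in>J. F i j)"
    using insert by simp
  finally show ?case by simp
qed

text \<open>The tropical determinant for an arbitrary index set, with matrices as functions, so that
  a choice of rows \<open>f\<close> is simply \<open>\<lambda>i. b (f i)\<close>.\<close>

definition permanent :: "'i set \<Rightarrow> ('i \<Rightarrow> 'i \<Rightarrow> 'a :: {comm_semiring_0, comm_monoid_mult}) \<Rightarrow> 'a"
  where "permanent I a = (\<Sum>\<pi> | \<pi> permutes I. \<Prod>i\<in>I. a i (\<pi> i))"

text \<open>Permuting the rows by \<open>\<sigma>\<close> amounts to composing each \<open>\<pi>\<close> with the inverse of \<open>\<sigma>\<close>, which
  only rearranges the sum over all permutations.\<close>

lemma permanent_permute_rows:
  assumes "\<sigma> permutes I"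
  shows "permanent I (\<lambda>i. b (\<sigma> i)) = permanent I b"
proof -
  have "permanent I (\<lambda>i. b (\<sigma> i))
      = (\<Sum>\<pi> | \<pi> permutes I. \<Prod>i\<in>I. b (\<sigma> i) ((\<pi> \<circ> \<sigma>) i))"
    unfolding permanent_def by (rule sum_permutations_compose_right[OF assms])
  also have "\<dots> = permanent I b"
    unfolding permanent_def
  proof (intro sum.cong refl)
    fix \<pi>
    show "(\<Prod>i\<in>I. b (\<sigma> i) ((\<pi> \<circ> \<sigma>) i)) = (\<Prod>i\<in>I. b i (\<pi> i))"
      using prod.permute[OF assms, of "\<lambda>i. b i (\<pi> i)"] by (simp add: comp_def)
  qed
  finally show ?thesis .
qed

text \<open>Composition with the transposition of the two equal rows changes the parity of a
  permutation but not its product, so the even and the odd permutations have the same sum.\<close>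

lemma permanent_equal_rows:
  assumes "finite I" and ij: "i \<in> I" "j \<in> I" "i \<noteq> j" and eq: "b i = b j"
  shows "\<exists>d. permanent I b = d + d"
proof -
  let ?\<tau> = "Transposition.transpose i j"
  let ?E = "{\<pi>. \<pi> permutes I \<and> evenperm \<pi>}" and ?O = "{\<pi>. \<pi> permutes I \<and> \<not> evenperm \<pi>}"
  let ?w = "\<lambda>\<pi>. \<Prod>k\<in>I. b k (\<pi> k)"
  have \<tau>: "?\<tau> permutes I" using ij by (simp add: permutes_swap_id)
  have parity: "evenperm (\<pi> \<circ> ?\<tau>) \<longleftrightarrow> \<not> evenperm \<pi>" if "\<pi> permutes I" for \<pi>
    using evenperm_comp[OF permutes_imp_permutation[OF \<open>finite I\<close> that] permutation_swap_id[of i j]]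
      ij(3) by (simp add: evenperm_swap)
  have weight: "?w (\<pi> \<circ> ?\<tau>) = ?w \<pi>" for \<pi>
  proof -
    have "b (?\<tau> k) = b k" for k using eq by (simp add: Transposition.transpose_def)
    then show ?thesis
      using prod.permute[OF \<tau>, of "\<lambda>k. b k (\<pi> k)"] by (simp add: comp_def)
  qed
  have "sum ?w ?O = sum ?w ?E"
    by (rule sum.reindex_bij_witness[where i = "\<lambda>\<pi>. \<pi> \<circ> ?\<tau>" and j = "\<lambda>\<pi>. \<pi> \<circ> ?\<tau>"])
      (auto simp: parity weight comp_assoc permutes_compose[OF \<tau>] simp del: comp_apply)
  moreover have "permanent I b = sum ?w ?E + sum ?w ?O"
  proof -
    have "finite {\<pi>. \<pi> permutes I}" using \<open>finite I\<close> by (rule finite_permutations)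
    then have "sum ?w (?E \<union> ?O) = sum ?w ?E + sum ?w ?O"
      by (intro sum.union_disjoint) (auto elim: rev_finite_subset)
    moreover have "?E \<union> ?O = {\<pi>. \<pi> permutes I}" by blast
    ultimately show ?thesis by (simp only: permanent_def)
  qed
  ultimately show ?thesis by auto
qed

lemma sum_is_double:
  fixes g :: "'i \<Rightarrow> 'a :: comm_monoid_add"
  assumes "\<And>i. i \<in> I \<Longrightarrow> \<exists>d. g i = d + d"
  shows "\<exists>d. sum g I = d + d"
proof -
  obtain h where "\<And>i. i \<in> I \<Longrightarrow> g i = h i + h i" using assms by metis
  then have "sum g I = sum h I + sum h I" by (simp add: sum.distrib)
  then show ?thesis ..
qed

text \<open>Permutations of \<open>I\<close> are the identity outside \<open>I\<close>, whereas the functions in \<open>I \<rightarrow>\<^sub>E I\<close> are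
  \<open>undefined\<close> there; restriction translates the first encoding into the second.\<close>

lemma bij_betw_restrict_permutes:
  assumes "finite I"
  shows "bij_betw (\<lambda>\<sigma>. restrict \<sigma> I) {\<sigma>. \<sigma> permutes I} {f \<in> I \<rightarrow>\<^sub>E I. inj_on f I}"
proof (rule bij_betwI[where g = "\<lambda>f i. if i \<in> I then f i else i"])
  show "(\<lambda>\<sigma>. restrict \<sigma> I) \<in> {\<sigma>. \<sigma> permutes I} \<rightarrow> {f \<in> I \<rightarrow>\<^sub>E I. inj_on f I}"
    by (auto simp: permutes_in_image permutes_inj_on inj_on_restrict_eq)
  show "(\<lambda>f i. if i \<in> I then f i else i) \<in> {f \<in> I \<rightarrow>\<^sub>E I. inj_on f I} \<rightarrow> {\<sigma>. \<sigma> permutes I}"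
  proof
    fix f assume f: "f \<in> {f \<in> I \<rightarrow>\<^sub>E I. inj_on f I}"
    then have "f ` I = I" using endo_inj_surj[OF assms, of f] by auto
    then have "bij_betw (\<lambda>i. if i \<in> I then f i else i) I I"
      using f by (simp add: bij_betw_def inj_on_def)
    then show "(\<lambda>i. if i \<in> I then f i else i) \<in> {\<sigma>. \<sigma> permutes I}"
      by (simp add: bij_imp_permutes)
  qed
  show "(\<lambda>i. if i \<in> I then restrict \<sigma> I i else i) = \<sigma>" if "\<sigma> \<in> {\<sigma>. \<sigma> permutes I}" for \<sigma>
    using that by (auto simp: fun_eq_iff permutes_not_in)
  show "restrict (\<lambda>i. if i \<in> I then f i else i) I = f" if "f \<in> {f \<in> I \<rightarrow>\<^sub>E I. inj_on f I}" for f
  proof -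
    have "restrict (\<lambda>i. if i \<in> I then f i else i) I = restrict f I" by (rule restrict_ext) simp
    also have "\<dots> = f" using that by (intro PiE_restrict) blast
    finally show ?thesis .
  qed
qed

lemma permanent_mult:
  assumes "finite I"
  shows "\<exists>d. permanent I (\<lambda>i j. \<Sum>k\<in>I. a i k * b k j) = permanent I a * permanent I b + (d + d)"
proof -
  let ?inj = "{f \<in> I \<rightarrow>\<^sub>E I. inj_on f I}" and ?noninj = "{f \<in> I \<rightarrow>\<^sub>E I. \<not> inj_on f I}"
  let ?t = "\<lambda>f. (\<Prod>i\<in>I. a i (f i)) * permanent I (\<lambda>i. b (f i))"
  have fin: "finite (I \<rightarrow>\<^sub>E I)" using assms by (simp add: finite_PiE)
  have "permanent I (\<lambda>i j. \<Sum>k\<in>I. a i k * b k j)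
      = (\<Sum>\<pi> | \<pi> permutes I. \<Sum>f\<in>I \<rightarrow>\<^sub>E I. (\<Prod>i\<in>I. a i (f i)) * (\<Prod>i\<in>I. b (f i) (\<pi> i)))"
    unfolding permanent_def prod_sum_expand_PiE[OF assms assms] prod.distrib ..
  also have "\<dots> = (\<Sum>f\<in>I \<rightarrow>\<^sub>E I. ?t f)"
    unfolding permanent_def sum_distrib_left by (rule sum.swap)
  also have "\<dots> = sum ?t ?inj + sum ?t ?noninj"
  proof -
    have "sum ?t (I \<rightarrow>\<^sub>E I) = sum ?t (?inj \<union> ?noninj)"
      by (rule arg_cong[where f = "sum ?t"]) blast
    also have "\<dots> = sum ?t ?inj + sum ?t ?noninj"
      using fin by (intro sum.union_disjoint) auto
    finally show ?thesis .
  qed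
  also have "sum ?t ?inj = permanent I a * permanent I b"
  proof -
    have "sum ?t ?inj = (\<Sum>\<sigma> | \<sigma> permutes I. ?t (restrict \<sigma> I))"
      by (rule sum.reindex_bij_betw[OF bij_betw_restrict_permutes[OF assms], symmetric])
    also have "\<dots> = (\<Sum>\<sigma> | \<sigma> permutes I. (\<Prod>i\<in>I. a i (\<sigma> i)) * permanent I b)"
    proof (intro sum.cong refl)
      fix \<sigma> assume "\<sigma> \<in> {\<sigma>. \<sigma> permutes I}"
      moreover have "permanent I (\<lambda>i. b (restrict \<sigma> I i)) = permanent I (\<lambda>i. b (\<sigma> i))"
        by (simp add: permanent_def)
      ultimately show "?t (restrict \<sigma> I) = (\<Prod>i\<in>I. a i (\<sigma> i)) * permanent I b"
        by (simp add: permanent_permute_rows)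
    qed
    also have "\<dots> = permanent I a * permanent I b"
      by (simp add: permanent_def sum_distrib_right)
    finally show ?thesis .
  qed
  finally have split: "permanent I (\<lambda>i j. \<Sum>k\<in>I. a i k * b k j)
      = permanent I a * permanent I b + sum ?t ?noninj" .
  have "\<exists>d. sum ?t ?noninj = d + d"
  proof (rule sum_is_double)
    fix f assume "f \<in> ?noninj"
    then obtain i j where "i \<in> I" "j \<in> I" "i \<noteq> j" "f i = f j" by (auto simp: inj_on_def)
    then obtain d where "permanent I (\<lambda>i. b (f i)) = d + d"
      using permanent_equal_rows[OF assms, of i j "\<lambda>i. b (f i)"] by auto
    then have "?t f = (\<Prod>i\<in>I. a i (f i)) * d + (\<Prod>i\<in>I. a i (f i)) * d"
      by (simp only: distrib_left)
    then show "\<exists>d. ?t f = d + d" by (rule exI)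
  qed
  then obtain d where "sum ?t ?noninj = d + d" ..
  from split[unfolded this] show ?thesis by (rule exI)
qed

lemma trop_det_eq_permanent:
  assumes "A \<in> carrier_mat n n"
  shows "trop_det A = permanent {0..<n} (\<lambda>i j. A $$ (i, j))"
  using assms by (simp add: trop_det_def permanent_def)

lemma trop_det_mult:
  fixes A B :: "'a :: {comm_semiring_0, comm_monoid_mult} mat"
  assumes A: "A \<in> carrier_mat n n" and B: "B \<in> carrier_mat n n"
  shows "\<exists>d. trop_det (A * B) = trop_det A * trop_det B + (d + d)"
proof -
  have "trop_det (A * B)
      = permanent {0..<n} (\<lambda>i j. \<Sum>k\<in>{0..<n}. A $$ (i, k) * B $$ (k, j))"
    unfolding trop_det_eq_permanent[OF mult_carrier_mat[OF A B]] permanent_def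
  proof (intro sum.cong prod.cong refl)
    fix \<pi> i assume "\<pi> \<in> {\<pi>. \<pi> permutes {0..<n}}" and i: "i \<in> {0..<n}"
    then have "\<pi> i \<in> {0..<n}" by (simp only: mem_Collect_eq permutes_in_image)
    with i A B show "(A * B) $$ (i, \<pi> i) = (\<Sum>k\<in>{0..<n}. A $$ (i, k) * B $$ (k, \<pi> i))"
      by (simp add: scalar_prod_def)
  qed
  then show ?thesis
    using permanent_mult[of "{0..<n}" "\<lambda>i k. A $$ (i, k)" "\<lambda>k j. B $$ (k, j)"]
    by (simp add: trop_det_eq_permanent[OF A] trop_det_eq_permanent[OF B])
qed

context supertropical_semiring
begin

text \<open>Addition is idempotent on ghosts, so \<open>\<nu> a\<close> is absorbed by \<open>\<nu> a + \<nu> c\<close>.\<close>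

lemma ghost_le_nu_add: "ghost_le G0 (\<nu> a) (\<nu> (a + c))"
proof -
  have "\<nu> a + \<nu> a = \<nu> a" using nu_eq[of "\<nu> a"] nu_idem[of a] by simp
  then show ?thesis by (simp add: ghost_le_def nu_in_G0 add_in_G0 nu_add add.assoc[symmetric])
qed

text \<open>Equal \<open>\<nu>\<close>-values would make the sum a ghost; for different ones the sum is one of the two
  summands, and it cannot be the ghost \<open>c\<close>.\<close>

lemma add_ghost_tangible:
  assumes "c \<in> G0" and "a + c \<in> tangible G0"
  shows "a + c = a"
proof -
  have "a + c \<notin> G0" using assms(2) by (simp add: tangible_def)
  then have "\<nu> a \<noteq> \<nu> c" using add_nu_eq[of a c] nu_in_G0[of a] by auto
  then show ?thesis using add_nu_neq[of a c] \<open>a + c \<notin> G0\<close> assms(1) by auto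
qed

end

theorem theorem3p5:
  fixes G0 :: "'a :: {comm_semiring_0, comm_monoid_mult} set"
    and \<nu> :: "'a \<Rightarrow> 'a"
    and n :: nat
    and A B :: "'a mat"
  assumes "supertropical_semiring G0 \<nu>"
    and "n \<ge> 1"
    and "A \<in> carrier_mat n n"
    and "B \<in> carrier_mat n n"
  shows "ghost_le G0 (\<nu> (trop_det A) * \<nu> (trop_det B)) (\<nu> (trop_det (A * B)))
    \<and> (trop_det (A * B) \<in> tangible G0 \<longrightarrow> trop_det (A * B) = trop_det A * trop_det B)
    \<and> (\<exists>c\<in>G0. trop_det (A * B) = trop_det A * trop_det B + c)"
proof -
  interpret supertropical_semiring G0 \<nu> by (rule assms(1))
  obtain d where "trop_det (A * B) = trop_det A * trop_det B + (d + d)"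
    using trop_det_mult[OF assms(3,4)] by blast
  then have eq: "trop_det (A * B) = trop_det A * trop_det B + \<nu> d"
    by (simp add: nu_eq)
  show ?thesis
    using ghost_le_nu_add[of "trop_det A * trop_det B" "\<nu> d"]
      add_ghost_tangible[OF nu_in_G0[of d], of "trop_det A * trop_det B"] nu_in_G0[of d] eq
    by (auto simp: nu_mult)
qed

end
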